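(* Let $0<\lambda\le 1$ and $1<p\le 5$. Let $u\in C([-\pi/2,\pi/2])\cap C^2((-\pi/2,\pi/2))$ be an even function with $u>0$ on $(-\pi/2,\pi/2)$ satisfying $$u_{rr}(r)-2(\tan r)u_r(r)-\lambda u(r)+u(r)^p=0,\quad r\in(-\pi/2,\pi/2),\qquad u(-\pi/2)=u(\pi/2)\ge 0.$$ Then $u\equiv|\lambda|^{1/(p-1)}$.
   Context: Subscripts $r$ denote derivatives; even means $u(-r)=u(r)$. *)

theory Defs
  imports "HOL-Analysis.Analysis"
begin

text \<open>
  The class \<open>C\<^sup>2(S)\<close> for an open set \<open>S\<close> of reals; openness makes \<^const>\<open>deriv\<close>, which is
  the derivative \<open>at x\<close> (not \<open>at x within S\<close>), agree with the derivative on \<open>S\<close>.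
\<close>
definition C2_on :: "real set \<Rightarrow> (real \<Rightarrow> real) \<Rightarrow> bool" where
  "C2_on S u \<longleftrightarrow>
     open S \<and> u differentiable_on S \<and> deriv u differentiable_on S \<and>
     continuous_on S (deriv (deriv u))"

end

(* With c = l powr (1/(p-1)) the quotient w = u/c solves w'' = 2 tan r w' - l (w^p - w) on
   [0,pi/2) with w'(0) = 0.  For multipliers N, S, M with S = M' + 4 tan r M and N' = -l S, the
   Pohozaev-type function Z = N (w^2 - w^(p+1)) + S w w' - M w'^2 satisfies
   Z' = (D1 w + D2 w^p) w', with D1, D2 depending on r only, and Z tends to 0 at pi/2.
   Suppose N, D1, D2 >= 0 and, say, w(0) > 1.  Then Z(0) <= 0, and Z decreases as long as w' < 0.
   At a first zero of w' one has w < 1, because the flux cos^2 r w' decreases while w > 1; hence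
   Z = N (w^2 - w^(p+1)) >= 0 there, a contradiction.  So w' < 0 throughout, and Z cannot tend
   to 0.  The case w(0) < 1 is the mirror image, so w(0) = 1, and w = 1 by uniqueness.
   The multipliers have the form M = a cos^2 r / 2.  For l <= 3/4, a = cos^m r with
   m = 2(p-1)/(p+3) gives D2 = 0.  For l > 3/4, a = sin(2 omega (pi/2 - r)) with
   omega^2 = 1 - l (or a = pi/2 - r if l = 1) gives D1 = 0. *)
theory Submission imports Defs begin

section \<open>Elementary inequalities\<close>

lemma cos_pos: "r \<in> {0..<pi/2} \<Longrightarrow> cos r > 0"
  by (intro cos_gt_zero_pi) (use pi_gt_zero in \<open>auto\<close>)

lemma eventually_at_left_pi_half:
  assumes "\<And>r. r \<in> {0..<pi/2} \<Longrightarrow> P r"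
  shows "eventually P (at_left (pi/2))"
  using eventually_at_left_real[of 0 "pi/2"] assms by (auto elim!: eventually_mono)

text \<open>Apply \<open>t * cos t <= sin t\<close> at half the angle:
  \<open>sin x = 2 * sin (x/2) * cos (x/2)\<close> is then at least
  \<open>x * cos (x/2)^2 = x/2 * (1 + cos x)\<close>. With \<open>x = pi/2 - r\<close> the bound
  compares the distance to \<open>pi/2\<close> with \<open>cos r\<close>.\<close>

lemma le_2_sin:
  fixes x :: real
  assumes x: "0 < x" "x \<le> pi/2"
  shows "x \<le> 2 * sin x"
proof -
  have y: "x/2 * cos (x/2) \<le> sin (x/2)"
  proof -
    have "sin 0 - 0 * cos 0 \<le> sin (x/2) - x/2 * cos (x/2)"
    proof (rule DERIV_nonneg_imp_nondecreasing[of 0 "x/2" "\<lambda>t. sin t - t * cos t"])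
      fix t assume t: "0 \<le> t" "t \<le> x/2"
      have "((\<lambda>t. sin t - t * cos t) has_real_derivative t * sin t) (at t)"
        by (auto intro!: derivative_eq_intros)
      moreover have "t * sin t \<ge> 0" using t x by (intro mult_nonneg_nonneg sin_ge_zero) auto
      ultimately show "\<exists>y. ((\<lambda>t. sin t - t * cos t) has_real_derivative y) (at t) \<and> 0 \<le> y"
        by blast
    qed (use x in auto)
    then show ?thesis by simp
  qed
  have c: "cos (x/2) \<ge> 0" "cos x \<ge> 0" using x by (auto intro!: cos_ge_zero)
  have "x/2 \<le> x/2 * (1 + cos x)" using x c by simp
  also have "\<dots> = 2 * (x/2 * cos (x/2)) * cos (x/2)"
    using cos_double_cos[of "x/2"] by (simp add: power2_eq_square)
  also have "\<dots> \<le> 2 * sin (x/2) * cos (x/2)"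
    using y c by (intro mult_right_mono) auto
  also have "\<dots> = sin x" using sin_double[of "x/2"] by simp
  finally show ?thesis by simp
qed

lemma sgn_powr_diff:
  fixes s x p :: real
  assumes "s = 1 \<or> s = -1" "x > 0" "p > 1" "s * (x - 1) > 0"
  shows "s * (x powr p - x) > 0"
  using assms powr_less_mono[of 1 p x] powr_less_mono'[of x 1 p] by auto

section \<open>The normalized equation and its flux near \<open>pi/2\<close>\<close>

locale normalized_solution =
  fixes l p :: real and w w' :: "real \<Rightarrow> real"
  assumes l_pos: "0 < l" and p_gt: "1 < p"
    and cont: "continuous_on {0..pi/2} w"
    and pos: "\<And>r. r \<in> {0..<pi/2} \<Longrightarrow> w r > 0"
    and deriv1: "\<And>r. r \<in> {0..<pi/2} \<Longrightarrow> (w has_real_derivative w' r) (at r)"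
    and deriv2: "\<And>r. r \<in> {0..<pi/2} \<Longrightarrow>
      (w' has_real_derivative 2 * tan r * w' r - l * (w r powr p - w r)) (at r)"
    and init: "w' 0 = 0"
begin

lemma nonneg: "r \<in> {0..pi/2} \<Longrightarrow> w r \<ge> 0"
  using continuous_ge_on_closure[of "{0..<pi/2}" w r 0] cont pos pi_gt_zero
  by (auto simp: less_imp_le)

text \<open>The factor \<open>cos^2\<close> is the integrating factor of the first-order term: the
  equation takes divergence form and the tangent drops out of the derivative.\<close>

definition flux :: "real \<Rightarrow> real" where "flux r = (cos r)\<^sup>2 * w' r"

lemma flux_deriv:
  assumes "r \<in> {0..<pi/2}"
  shows "(flux has_real_derivative - l * (cos r)\<^sup>2 * (w r powr p - w r)) (at r)"
  unfolding flux_def[abs_def] using cos_pos[OF assms]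
  by (auto intro!: derivative_eq_intros deriv2[OF assms] simp: tan_def field_simps power2_eq_square)

text \<open>Since \<open>w\<close> is continuous up to \<open>pi/2\<close>, the right-hand side of
  the divergence form is bounded, although \<open>w'\<close> itself has no bound yet.\<close>

lemma flux_diff_le:
  obtains C where "C > 0"
    "\<And>r t. r \<in> {0..<pi/2} \<Longrightarrow> t \<in> {r..<pi/2} \<Longrightarrow> \<bar>flux t - flux r\<bar> \<le> C * (t - r)"
proof -
  have "continuous_on {0..pi/2} (\<lambda>r. w r powr p - w r)"
    using p_gt nonneg by (intro continuous_intros cont continuous_on_powr') auto
  then have "bounded ((\<lambda>r. w r powr p - w r) ` {0..pi/2})"
    by (intro compact_imp_bounded compact_continuous_image) auto
  then have "\<exists>B>0. \<forall>r\<in>{0..pi/2}. \<bar>w r powr p - w r\<bar> \<le> B"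
    unfolding bounded_pos by auto
  then obtain B where B: "B > 0" "\<And>r. r \<in> {0..pi/2} \<Longrightarrow> \<bar>w r powr p - w r\<bar> \<le> B"
    by blast
  show ?thesis
  proof (rule that[of "l * B"])
    show "l * B > 0" using B l_pos by simp
    fix r t assume r: "r \<in> {0..<pi/2}" and t: "t \<in> {r..<pi/2}"
    have "norm (flux t - flux r) \<le> l * B * norm (t - r)"
    proof (rule field_differentiable_bound[of "{r..t}" flux
          "\<lambda>x. - l * (cos x)\<^sup>2 * (w x powr p - w x)"])
      fix x assume x: "x \<in> {r..t}"
      then have x': "x \<in> {0..<pi/2}" using r t by auto
      then show "(flux has_real_derivative - l * (cos x)\<^sup>2 * (w x powr p - w x)) (at x within {r..t})"
        by (rule has_field_derivative_at_within[OF flux_deriv])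
      have "(cos x)\<^sup>2 * \<bar>w x powr p - w x\<bar> \<le> 1 * B"
        using B x' by (intro mult_mono) (auto simp: abs_square_le_1)
      then show "norm (- l * (cos x)\<^sup>2 * (w x powr p - w x)) \<le> l * B"
        using l_pos by (simp add: abs_mult)
    qed (use r t in auto)
    then show "\<bar>flux t - flux r\<bar> \<le> l * B * (t - r)" using t by auto
  qed
qed

text \<open>A flux that does not vanish at \<open>pi/2\<close> would make \<^term>\<open>w\<close> grow like \<^term>\<open>tan\<close>.\<close>

lemma flux_le:
  assumes C: "C > 0"
    "\<And>r t. r \<in> {0..<pi/2} \<Longrightarrow> t \<in> {r..<pi/2} \<Longrightarrow> \<bar>flux t - flux r\<bar> \<le> C * (t - r)"
    and r: "r \<in> {0..<pi/2}"
  shows "\<bar>flux r\<bar> \<le> C * (pi/2 - r)"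
proof (rule ccontr)
  define s where "s = sgn (flux r)"
  \<comment> \<open>\<open>C * (pi/2 - r)\<close> is the most that the flux can lose between
    \<open>r\<close> and \<open>pi/2\<close>, so \<open>d\<close> is what is left of it on the whole
    of that interval.\<close>
  define d where "d = \<bar>flux r\<bar> - C * (pi/2 - r)"
  assume "\<not> ?thesis"
  then have d: "d > 0" by (simp add: d_def)
  have sf: "s * flux r = \<bar>flux r\<bar>" by (simp add: s_def mult.commute abs_sgn)
  have s1: "\<bar>s\<bar> \<le> 1" by (simp add: s_def sgn_if)
  have lb: "s * flux t \<ge> d" if t: "t \<in> {r..<pi/2}" for t
  proof -
    have "\<bar>s * (flux t - flux r)\<bar> \<le> 1 * (C * (t - r))"
      unfolding abs_mult using s1 C(2)[OF r t] by (intro mult_mono) auto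
    also have "\<dots> \<le> C * (pi/2 - r)" using C(1) t by auto
    finally show ?thesis using sf unfolding d_def right_diff_distrib by linarith
  qed
  \<comment> \<open>Dividing the lower bound \<open>d\<close> for the flux by \<open>cos^2\<close>
    bounds \<open>s * w'\<close> below by the derivative of \<open>d * tan\<close>.\<close>
  have grow: "s * w t - d * tan t \<ge> s * w r - d * tan r" if t: "t \<in> {r..<pi/2}" for t
  proof (rule DERIV_nonneg_imp_nondecreasing[of r t "\<lambda>x. s * w x - d * tan x"])
    show "r \<le> t" using t by simp
    fix x assume x: "r \<le> x" "x \<le> t"
    then have x': "x \<in> {0..<pi/2}" "x \<in> {r..<pi/2}" using r t by auto
    have "((\<lambda>x. s * w x - d * tan x) has_real_derivative
        s * w' x - d * inverse ((cos x)\<^sup>2)) (at x)"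
      using cos_pos[OF x'(1)]
      by (auto intro!: derivative_eq_intros deriv1[OF x'(1)])
    moreover have "s * w' x - d * inverse ((cos x)\<^sup>2) \<ge> 0"
      using lb[OF x'(2)] cos_pos[OF x'(1)] by (simp add: flux_def field_simps)
    ultimately show "\<exists>y. ((\<lambda>x. s * w x - d * tan x) has_real_derivative y) (at x) \<and> 0 \<le> y"
      by blast
  qed
  have "bounded (w ` {0..pi/2})"
    by (intro compact_imp_bounded compact_continuous_image cont) auto
  then have "\<exists>B. \<forall>r\<in>{0..pi/2}. \<bar>w r\<bar> \<le> B"
    unfolding bounded_iff by auto
  then obtain B where B: "\<And>r. r \<in> {0..pi/2} \<Longrightarrow> \<bar>w r\<bar> \<le> B"
    by blast
  have up: "tan t \<le> tan r + 2 * B / d" if t: "t \<in> {r..<pi/2}" for t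
  proof -
    have "\<bar>s * w x\<bar> \<le> 1 * B" if "x \<in> {0..pi/2}" for x
      unfolding abs_mult using s1 B[OF that] by (intro mult_mono) auto
    from this[of t] this[of r] have "\<bar>s * w t\<bar> \<le> B" "\<bar>s * w r\<bar> \<le> B"
      using r t by auto
    then have "d * tan t \<le> d * tan r + 2 * B" using grow[OF t] by linarith
    then show ?thesis using d by (simp add: field_simps)
  qed
  have "eventually (\<lambda>t. tan t > tan r + 2 * B / d) (at_left (pi/2))"
    using filterlim_tan_at_left by (auto simp: filterlim_at_top_dense)
  moreover have "eventually (\<lambda>t. t \<in> {r<..<pi/2}) (at_left (pi/2))"
    using r by (intro eventually_at_left_real) auto
  ultimately have "eventually (\<lambda>t::real. False) (at_left (pi/2))"
  proof eventually_elim
    case (elim t)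
    then show ?case using up[of t] by simp
  qed
  then show False by simp
qed

text \<open>The flux vanishes linearly at \<open>pi/2\<close>, and so does the cosine; dividing by
  one factor \<open>cos r\<close> leaves a bounded quantity. This rate decides how fast
  \<open>S\<close> and \<open>M\<close> must vanish for \<open>Z\<close> to tend to 0.\<close>

lemma cos_deriv_bounded:
  obtains C where "C > 0" "\<And>r. r \<in> {0..<pi/2} \<Longrightarrow> \<bar>cos r * w' r\<bar> \<le> C"
proof -
  obtain C where C: "C > 0"
    "\<And>r t. r \<in> {0..<pi/2} \<Longrightarrow> t \<in> {r..<pi/2} \<Longrightarrow> \<bar>flux t - flux r\<bar> \<le> C * (t - r)"
    using flux_diff_le by blast
  show ?thesis
  proof (rule that[of "C * 2"])
    show "C * 2 > 0" using C by simp
    fix r assume r: "r \<in> {0..<pi/2}"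
    define x where "x = pi/2 - r"
    have x: "0 < x" "x \<le> pi/2" using r by (auto simp: x_def)
    have "cos r * \<bar>cos r * w' r\<bar> = \<bar>flux r\<bar>"
      using cos_pos[OF r] by (simp add: flux_def abs_mult power2_eq_square)
    also have "\<dots> \<le> C * x" using flux_le[OF C r] by (simp add: x_def)
    also have "\<dots> \<le> C * (2 * cos r)"
      using C le_2_sin[of x] x by (intro mult_left_mono) (auto simp: x_def sin_diff)
    finally have "cos r * \<bar>cos r * w' r\<bar> \<le> cos r * (C * 2)" by (simp add: ac_simps)
    then show "\<bar>cos r * w' r\<bar> \<le> C * 2" using cos_pos[OF r] by simp
  qed
qed

section \<open>Uniqueness for the initial value 1\<close>

lemma eq_1_if_init_eq_1:
  assumes w0: "w 0 = 1" and r: "r \<in> {0..<pi/2}"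
  shows "w r = 1"
proof -
  \<comment> \<open>The energy with potential \<open>\<Phi>\<close> increases, but weighted by \<open>cos r ^ 4\<close> it decreases.\<close>
  define \<Phi> where "\<Phi> x = (x powr (p + 1) - 1) / (p + 1) - (x\<^sup>2 - 1) / 2" for x :: real
  have \<Phi>_deriv: "(\<Phi> has_real_derivative x powr p - x) (at x)" if "x > 0" for x
  proof -
    have "((\<lambda>x. x powr (p + 1)) has_real_derivative (p + 1) * x powr p) (at x)"
      using has_real_derivative_powr[OF that, of "p + 1"] by simp
    from DERIV_cdivide[OF this, of "p + 1"]
    have "((\<lambda>x. x powr (p + 1) / (p + 1)) has_real_derivative x powr p) (at x)"
      using p_gt by simp
    moreover have "((\<lambda>x. x\<^sup>2 / 2) has_real_derivative x) (at x)"
      by (auto intro!: derivative_eq_intros)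
    ultimately have "((\<lambda>x. x powr (p + 1) / (p + 1) - x\<^sup>2 / 2 + (1 / 2 - 1 / (p + 1)))
        has_real_derivative x powr p - x + 0) (at x)"
      by (intro DERIV_add DERIV_diff DERIV_const)
    then show ?thesis
      unfolding \<Phi>_def[abs_def] by (simp add: diff_divide_distrib algebra_simps)
  qed
  \<comment> \<open>The derivative \<open>x powr p - x\<close> changes sign at 1 only, so \<Phi> has
    its minimum there, and it is normalized to have the value 0 at 1.\<close>
  have \<Phi>_nonneg: "\<Phi> x \<ge> 0" if x: "x > 0" for x
  proof (cases "x \<ge> 1")
    case True
    have "\<Phi> 1 \<le> \<Phi> x"
    proof (rule DERIV_nonneg_imp_nondecreasing[OF True])
      fix y assume y: "1 \<le> y" "y \<le> x"
      then have "y powr p - y \<ge> 0" using powr_mono[of 1 p y] p_gt by simp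
      then show "\<exists>z. (\<Phi> has_real_derivative z) (at y) \<and> 0 \<le> z" using \<Phi>_deriv[of y] y by auto
    qed
    then show ?thesis by (simp add: \<Phi>_def)
  next
    case False
    have "\<Phi> x \<ge> \<Phi> 1"
    proof (rule DERIV_nonpos_imp_nonincreasing[of x 1 \<Phi>])
      show "x \<le> 1" using False by simp
      fix y assume y: "x \<le> y" "y \<le> 1"
      then have "y powr p - y \<le> 0" using powr_mono'[of 1 p y] p_gt x by simp
      then show "\<exists>z. (\<Phi> has_real_derivative z) (at y) \<and> z \<le> 0"
        using \<Phi>_deriv[of y] x y by auto
    qed
    then show ?thesis by (simp add: \<Phi>_def)
  qed
  define E where "E r = ((w' r)\<^sup>2 / 2 + l * \<Phi> (w r)) * cos r ^ 4" for r
  have E_deriv: "(E has_real_derivative - 4 * (l * cos x ^ 3 * sin x * \<Phi> (w x))) (at x)"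
    if x: "x \<in> {0..<pi/2}" for x
  proof -
    have "((\<lambda>r. \<Phi> (w r)) has_real_derivative (w x powr p - w x) * w' x) (at x)"
      by (rule DERIV_chain2[OF \<Phi>_deriv[OF pos[OF x]] deriv1[OF x]])
    then have "(E has_real_derivative
        (w' x * (2 * tan x * w' x - l * (w x powr p - w x)) + l * ((w x powr p - w x) * w' x)) * cos x ^ 4
        - ((w' x)\<^sup>2 / 2 + l * \<Phi> (w x)) * (4 * cos x ^ 3 * sin x)) (at x)"
      unfolding E_def[abs_def] by (auto intro!: derivative_eq_intros deriv2[OF x])
    \<comment> \<open>The unweighted energy grows at the rate \<open>2 * tan x * (w' x)^2\<close>.
      The fourth power is chosen so that the derivative of the weight cancels this kinetic term
      exactly and only the potential term remains.\<close>
    also have "w' x * (2 * tan x * w' x - l * (w x powr p - w x)) + l * ((w x powr p - w x) * w' x)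
        = 2 * tan x * (w' x)\<^sup>2"
      by (simp add: algebra_simps power2_eq_square)
    also have "2 * tan x * (w' x)\<^sup>2 * cos x ^ 4 = 2 * sin x * cos x ^ 3 * (w' x)\<^sup>2"
      using cos_pos[OF x] by (simp add: tan_def power_eq_if)
    also have "2 * sin x * cos x ^ 3 * (w' x)\<^sup>2 - ((w' x)\<^sup>2 / 2 + l * \<Phi> (w x)) * (4 * cos x ^ 3 * sin x)
        = - 4 * (l * cos x ^ 3 * sin x * \<Phi> (w x))"
      by (simp add: algebra_simps)
    finally show ?thesis .
  qed
  have w'0: "w' x = 0" if x: "x \<in> {0..<pi/2}" for x
  proof -
    \<comment> \<open>The initial data give \<open>E 0 = 0\<close>. Both terms of \<open>E\<close>
      are nonnegative, so monotonicity forces them to vanish.\<close>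
    have "E x \<le> E 0"
    proof (rule DERIV_nonpos_imp_nonincreasing[of 0 x E])
      show "0 \<le> x" using x by simp
      fix y assume y: "0 \<le> y" "y \<le> x"
      then have y': "y \<in> {0..<pi/2}" using x by simp
      have "0 \<le> l * cos y ^ 3 * sin y * \<Phi> (w y)"
        using l_pos cos_pos[OF y'] \<Phi>_nonneg[OF pos[OF y']] sin_ge_zero[of y] y' by simp
      then show "\<exists>z. (E has_real_derivative z) (at y) \<and> z \<le> 0"
        using E_deriv[OF y'] by (intro exI[of _ "- 4 * (l * cos y ^ 3 * sin y * \<Phi> (w y))"]) simp
    qed
    then have "((w' x)\<^sup>2 / 2 + l * \<Phi> (w x)) * cos x ^ 4 \<le> 0"
      by (simp add: E_def w0 init \<Phi>_def)
    then have "(w' x)\<^sup>2 / 2 + l * \<Phi> (w x) \<le> 0"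
      using cos_pos[OF x] by (simp add: mult_le_0_iff)
    moreover have "l * \<Phi> (w x) \<ge> 0" using l_pos \<Phi>_nonneg[OF pos[OF x]] by simp
    ultimately have "(w' x)\<^sup>2 \<le> 0" by linarith
    then show ?thesis by simp
  qed
  have "w r = w 0"
  proof (cases "r = 0")
    case False
    show ?thesis
    proof (rule DERIV_isconst_end[of 0 r w])
      show "continuous_on {0..r} w"
        using r by (intro continuous_on_subset[OF cont]) auto
      fix x assume "0 < x" "x < r"
      then have "x \<in> {0..<pi/2}" using r by simp
      then show "(w has_real_derivative 0) (at x)" using deriv1[of x] w'0[of x] by simp
    qed (use False r in simp)
  qed simp
  then show ?thesis using w0 by simp
qed

section \<open>The comparison argument for abstract multipliers\<close>

text \<open>The sign \<open>s\<close> of \<open>w 0 - 1\<close> lets the proof treat \<open>w 0 > 1\<close> and \<open>w 0 < 1\<close> at once.\<close>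

lemma init_eq_1:
  fixes N S M D\<^sub>1 D\<^sub>2 :: "real \<Rightarrow> real"
  defines "Z \<equiv> \<lambda>r. N r * ((w r)\<^sup>2 - w r powr (p + 1)) + S r * w r * w' r - M r * (w' r)\<^sup>2"
  assumes Z_deriv: "\<And>r. r \<in> {0..<pi/2} \<Longrightarrow>
      (Z has_real_derivative (D\<^sub>1 r * w r + D\<^sub>2 r * w r powr p) * w' r) (at r)"
    and N: "\<And>r. r \<in> {0..<pi/2} \<Longrightarrow> N r \<ge> 0"
    and D: "\<And>r. r \<in> {0..<pi/2} \<Longrightarrow> D\<^sub>1 r \<ge> 0" "\<And>r. r \<in> {0..<pi/2} \<Longrightarrow> D\<^sub>2 r \<ge> 0"
    and strict: "N 0 > 0 \<or> (\<forall>r\<in>{0<..<pi/2}. D\<^sub>1 r > 0 \<or> D\<^sub>2 r > 0)"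
    and lim_N: "(N \<longlongrightarrow> 0) (at_left (pi/2))"
    and lim_S: "((\<lambda>r. S r / cos r) \<longlongrightarrow> 0) (at_left (pi/2))"
    and lim_M: "((\<lambda>r. M r / (cos r)\<^sup>2) \<longlongrightarrow> 0) (at_left (pi/2))"
  shows "w 0 = 1"
proof (rule ccontr)
  assume "w 0 \<noteq> 1"
  define s where "s = sgn (w 0 - 1)"
  have s: "s = 1 \<or> s = -1" and s0: "s * (w 0 - 1) > 0"
    using \<open>w 0 \<noteq> 1\<close> by (auto simp: s_def sgn_if)
  have DD: "D\<^sub>1 r * w r + D\<^sub>2 r * w r powr p \<ge> 0" if "r \<in> {0..<pi/2}" for r
    using D[OF that] pos[OF that] by simp
  have sq_minus: "x\<^sup>2 - x powr (p + 1) = - (x * (x powr p - x))" if "x > 0" for x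
    using that by (simp add: powr_add algebra_simps power2_eq_square)
  have neg_if: "s * Z r < 0"
    if r: "r \<in> {0<..<pi/2}" and desc: "\<And>t. t \<in> {0<..<r} \<Longrightarrow> s * w' t < 0" for r
  proof -
    have Z0: "s * Z 0 = - (N 0 * (w 0 * (s * (w 0 powr p - w 0))))"
      using sq_minus[OF pos[of 0]] by (simp add: Z_def init)
    have pos0: "w 0 * (s * (w 0 powr p - w 0)) > 0"
      using sgn_powr_diff[OF s pos[of 0] p_gt s0] pos[of 0] by simp
    have cont_Z: "continuous_on {0..r} (\<lambda>x. s * Z x)"
      using r by (intro continuous_intros DERIV_continuous_on)
        (auto intro!: has_field_derivative_at_within[OF Z_deriv])
    show ?thesis
    \<comment> \<open>Strictness comes either from the starting value of \<open>s * Z\<close> or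
      from its decrease. The second source is needed for \<open>l = 1\<close>, where the multiplier
      used below has \<open>N 0 = 0\<close>.\<close>
    proof (cases "N 0 > 0")
      case True
      have "s * Z r \<le> s * Z 0"
      proof (rule DERIV_nonpos_imp_decreasing_open[OF _ _ cont_Z])
        fix x assume "0 < x" "x < r"
        then have x: "x \<in> {0..<pi/2}" "x \<in> {0<..<r}" using r by auto
        have "(D\<^sub>1 x * w x + D\<^sub>2 x * w x powr p) * (s * w' x) \<le> 0"
          using DD[OF x(1)] desc[OF x(2)] by (simp add: mult_nonneg_nonpos)
        then show "\<exists>y. ((\<lambda>x. s * Z x) has_real_derivative y) (at x) \<and> y \<le> 0"
          using DERIV_cmult[OF Z_deriv[OF x(1)], of s] by (auto simp: ac_simps)
      qed (use r in auto)
      moreover have "s * Z 0 < 0" using Z0 pos0 True by simp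
      ultimately show ?thesis by simp
    next
      case False
      have "s * Z r < s * Z 0"
      proof (rule DERIV_neg_imp_decreasing_open[OF _ _ cont_Z])
        fix x assume "0 < x" "x < r"
        then have x: "x \<in> {0..<pi/2}" "x \<in> {0<..<r}" "x \<in> {0<..<pi/2}" using r by auto
        have "D\<^sub>1 x > 0 \<or> D\<^sub>2 x > 0" using strict False x(3) by blast
        then have "D\<^sub>1 x * w x + D\<^sub>2 x * w x powr p > 0"
          using D[OF x(1)] pos[OF x(1)]
          by (elim disjE) (simp_all add: add_pos_nonneg add_nonneg_pos)
        then have "(D\<^sub>1 x * w x + D\<^sub>2 x * w x powr p) * (s * w' x) < 0"
          using desc[OF x(2)] by (simp add: mult_pos_neg)
        then show "\<exists>y. ((\<lambda>x. s * Z x) has_real_derivative y) (at x) \<and> y < 0"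
          using DERIV_cmult[OF Z_deriv[OF x(1)], of s] by (auto simp: ac_simps)
      qed (use r in auto)
      moreover have "s * Z 0 \<le> 0" using Z0 pos0 N[of 0] by simp
      ultimately show ?thesis by simp
    qed
  qed
  have flux_neg: "s * flux b < s * flux a"
    if ab: "0 \<le> a" "a < b" "b < pi/2" and gt: "\<And>t. t \<in> {a<..<b} \<Longrightarrow> s * (w t - 1) > 0" for a b
  proof (rule DERIV_neg_imp_decreasing_open[OF ab(2)])
    fix x assume "a < x" "x < b"
    then have x: "x \<in> {0..<pi/2}" "x \<in> {a<..<b}" using ab by auto
    have "(l * (cos x)\<^sup>2) * (s * (w x powr p - w x)) > 0"
      using l_pos cos_pos[OF x(1)] sgn_powr_diff[OF s pos[OF x(1)] p_gt gt[OF x(2)]] by simp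
    moreover have "((\<lambda>x. s * flux x) has_real_derivative
        - ((l * (cos x)\<^sup>2) * (s * (w x powr p - w x)))) (at x)"
      using DERIV_cmult[OF flux_deriv[OF x(1)], of s] by (simp add: mult_ac)
    ultimately show "\<exists>y. ((\<lambda>x. s * flux x) has_real_derivative y) (at x) \<and> y < 0"
      by (meson neg_less_0_iff_less)
  next
    show "continuous_on {a..b} (\<lambda>x. s * flux x)"
      using ab by (intro continuous_intros DERIV_continuous_on)
        (auto intro!: has_field_derivative_at_within[OF flux_deriv])
  qed
  have flux_sign: "s * flux r < 0 \<longleftrightarrow> s * w' r < 0" if "r \<in> {0..<pi/2}" for r
    using cos_pos[OF that] by (auto simp: flux_def mult_less_0_iff zero_less_mult_iff)
  have mono: "s * w' r < 0" if r: "r \<in> {0<..<pi/2}" for r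
  proof (rule ccontr)
    assume "\<not> ?thesis"
    then have nonneg_r: "s * flux r \<ge> 0" using flux_sign[of r] r by auto
    \<comment> \<open>The flux vanishes at 0, so its sign just to the right is obtained from
      \<open>flux_neg\<close>, on an interval where continuity keeps \<open>s * (w t - 1)\<close>
      positive.\<close>
    have "isCont (\<lambda>t. s * (w t - 1)) 0"
      by (intro continuous_intros DERIV_isCont[OF deriv1]) auto
    then have "eventually (\<lambda>t. s * (w t - 1) > 0) (at 0)"
      using s0 by (intro order_tendstoD) (auto simp: isCont_def)
    then obtain d where d: "d > 0" "\<And>t. t \<noteq> 0 \<Longrightarrow> \<bar>t\<bar> < d \<Longrightarrow> s * (w t - 1) > 0"
      unfolding eventually_at by (auto simp: dist_real_def)
    define e where "e = min (d / 2) (r / 2)"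
    have e: "0 < e" "e < d" "e < r" using d(1) r by (auto simp: e_def)
    have near: "s * flux t < 0" if "t \<in> {0<..e}" for t
      using flux_neg[of 0 t] that e r d(2) by (auto simp: flux_def init)
    \<comment> \<open>Starting at \<open>e\<close> keeps out the zero of the flux at 0, so
      \<open>Inf A\<close> is the first later point where the sign fails.\<close>
    define A where "A = {e..r} \<inter> (\<lambda>t. s * flux t) -` {0..}"
    have "continuous_on {e..r} (\<lambda>x. s * flux x)"
      using r e by (intro continuous_intros DERIV_continuous_on)
        (auto intro!: has_field_derivative_at_within[OF flux_deriv])
    then have "closed A" unfolding A_def by (intro continuous_closed_preimage) auto
    have "r \<in> A" using nonneg_r e by (simp add: A_def)
    have "bdd_below A" by (auto simp: A_def)
    define q where "q = Inf A"
    have "q \<in> A" unfolding q_def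
      using closed_contains_Inf[OF _ \<open>bdd_below A\<close> \<open>closed A\<close>] \<open>r \<in> A\<close> by blast
    then have q: "e \<le> q" "q \<le> r" "s * flux q \<ge> 0" by (auto simp: A_def)
    have q_pos: "q \<in> {0<..<pi/2}" "q \<in> {0..<pi/2}" using q e r by auto
    have before: "s * flux t < 0" if t: "t \<in> {0<..<q}" for t
    proof (cases "t \<le> e")
      case False
      then have "t \<notin> A" using cInf_lower[OF _ \<open>bdd_below A\<close>, of t] t unfolding q_def by auto
      then show ?thesis using False t q by (auto simp: A_def)
    qed (use near t in auto)
    have desc: "s * w' t < 0" if "t \<in> {0<..<q}" for t
      using before[OF that] flux_sign[of t] that q_pos by auto
    \<comment> \<open>Membership in \<open>A\<close> gives \<open>s * flux q >= 0\<close> and the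
      limit from the left gives the reverse inequality, so \<open>q\<close> is a critical point of
      \<open>w\<close>.\<close>
    have "((\<lambda>t. s * flux t) \<longlongrightarrow> s * flux q) (at_left q)"
      using continuous_at_imp_continuous_at_within[OF DERIV_isCont[OF flux_deriv[OF q_pos(2)]]]
      by (intro tendsto_mult_left) (simp add: continuous_within)
    moreover have "eventually (\<lambda>t. s * flux t \<le> 0) (at_left q)"
      using eventually_at_left_real[of 0 q] q_pos(1) before
      by (auto elim!: eventually_mono intro: less_imp_le)
    ultimately have "s * flux q \<le> 0" by (rule tendsto_upperbound) simp
    then have "w' q = 0"
      using q(3) s cos_pos[OF q_pos(2)] by (auto simp: flux_def)
    have w_dec: "s * w q < s * w t" if t: "t \<in> {0..<q}" for t
    proof (rule DERIV_neg_imp_decreasing_open[of t q "\<lambda>x. s * w x"])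
      fix x assume "t < x" "x < q"
      then have "x \<in> {0..<pi/2}" "x \<in> {0<..<q}" using t q_pos by auto
      then show "\<exists>y. ((\<lambda>x. s * w x) has_real_derivative y) (at x) \<and> y < 0"
        using DERIV_cmult[OF deriv1, of x s] desc by blast
    next
      show "continuous_on {t..q} (\<lambda>x. s * w x)"
        using t q_pos by (intro continuous_intros continuous_on_subset[OF cont]) auto
    qed (use t in auto)
    \<comment> \<open>Otherwise strict monotonicity of \<open>s * w\<close> keeps
      \<open>s * (w t - 1)\<close> positive on all of \<open>(0, q)\<close>, and
      \<open>s * flux\<close> ends strictly below its initial value 0.\<close>
    have "s * (w q - 1) < 0"
    proof (rule ccontr)
      assume c: "\<not> ?thesis"
      have "s * flux q < s * flux 0"
      proof (rule flux_neg)
        fix t assume "t \<in> {0<..<q}"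
        then show "s * (w t - 1) > 0" using c w_dec[of t] by (simp add: right_diff_distrib)
      qed (use q_pos in auto)
      then show False using q(3) by (simp add: flux_def init)
    qed
    \<comment> \<open>The sign is \<open>- s\<close> because \<open>w q\<close> and
      \<open>w 0\<close> lie on opposite sides of 1. At \<open>q\<close> only the \<open>N\<close>
      term of \<open>Z\<close> survives, and its sign contradicts \<open>neg_if\<close>.\<close>
    then have "(- s) * (w q powr p - w q) > 0"
      using s by (intro sgn_powr_diff pos q_pos p_gt) auto
    from mult_nonneg_nonneg[OF N[OF q_pos(2)] less_imp_le[OF mult_pos_pos[OF pos[OF q_pos(2)] this]]]
    have "N q * (w q * ((- s) * (w q powr p - w q))) \<ge> 0" .
    then have "s * Z q \<ge> 0"
      using sq_minus[OF pos[OF q_pos(2)]] by (simp add: Z_def \<open>w' q = 0\<close> mult.left_commute[of s])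
    then show False using neg_if[OF q_pos(1) desc] by simp
  qed
  have Z_lim: "((\<lambda>r. s * Z r) \<longlongrightarrow> 0) (at_left (pi/2))"
  proof -
    obtain C where C: "C > 0" "\<And>r. r \<in> {0..<pi/2} \<Longrightarrow> \<bar>cos r * w' r\<bar> \<le> C"
      using cos_deriv_bounded by blast
    have bdd: "\<exists>B. \<forall>r\<in>{0..pi/2}. \<bar>f r\<bar> \<le> B" if "continuous_on {0..pi/2} f" for f :: "real \<Rightarrow> real"
      using compact_imp_bounded[OF compact_continuous_image[OF that compact_Icc]]
      unfolding bounded_iff by auto
    obtain B where B: "\<And>r. r \<in> {0..pi/2} \<Longrightarrow> \<bar>w r\<bar> \<le> B"
      using bdd[OF cont] by blast
    have "continuous_on {0..pi/2} (\<lambda>r. (w r)\<^sup>2 - w r powr (p + 1))"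
      using p_gt nonneg by (intro continuous_intros cont continuous_on_powr') auto
    then obtain B' where B': "\<And>r. r \<in> {0..pi/2} \<Longrightarrow> \<bar>(w r)\<^sup>2 - w r powr (p + 1)\<bar> \<le> B'"
      using bdd by blast
    have bound: "norm (s * Z r) \<le> \<bar>N r\<bar> * B' + \<bar>S r / cos r\<bar> * (B * C) + \<bar>M r / (cos r)\<^sup>2\<bar> * C\<^sup>2"
      if r: "r \<in> {0<..<pi/2}" for r
    proof -
      have r': "r \<in> {0..<pi/2}" "r \<in> {0..pi/2}" using r by auto
      \<comment> \<open>Each \<open>w'\<close> is paired with a cosine so that
        \<open>cos_deriv_bounded\<close> applies; the weights left over are those assumed to tend to
        0.\<close>
      have "Z r = N r * ((w r)\<^sup>2 - w r powr (p + 1)) + S r / cos r * (w r * (cos r * w' r))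
          - M r / (cos r)\<^sup>2 * (cos r * w' r)\<^sup>2"
        using cos_pos[OF r'(1)] by (simp add: Z_def power_mult_distrib)
      moreover have "\<bar>N r * ((w r)\<^sup>2 - w r powr (p + 1))\<bar> \<le> \<bar>N r\<bar> * B'"
        unfolding abs_mult using B'[OF r'(2)] by (intro mult_left_mono) auto
      moreover have "\<bar>S r / cos r * (w r * (cos r * w' r))\<bar> \<le> \<bar>S r / cos r\<bar> * (B * C)"
        unfolding abs_mult[of "S r / cos r"] abs_mult[of "w r"]
        using B[OF r'(2)] C(2)[OF r'(1)] by (intro mult_left_mono mult_mono) auto
      moreover have "\<bar>M r / (cos r)\<^sup>2 * (cos r * w' r)\<^sup>2\<bar> \<le> \<bar>M r / (cos r)\<^sup>2\<bar> * C\<^sup>2"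
        unfolding abs_mult[of "M r / (cos r)\<^sup>2"] abs_power2
        using power_mono[OF C(2)[OF r'(1)], of 2] by (intro mult_left_mono) auto
      ultimately have "\<bar>Z r\<bar> \<le> \<bar>N r\<bar> * B' + \<bar>S r / cos r\<bar> * (B * C) + \<bar>M r / (cos r)\<^sup>2\<bar> * C\<^sup>2"
        by linarith
      then show ?thesis using s by auto
    qed
    show ?thesis
    proof (rule Lim_null_comparison)
      show "eventually (\<lambda>r. norm (s * Z r) \<le>
          \<bar>N r\<bar> * B' + \<bar>S r / cos r\<bar> * (B * C) + \<bar>M r / (cos r)\<^sup>2\<bar> * C\<^sup>2) (at_left (pi/2))"
        using eventually_at_left_real[of 0 "pi/2"] bound by (auto elim!: eventually_mono)
      have "((\<lambda>r. \<bar>N r\<bar> * B' + \<bar>S r / cos r\<bar> * (B * C) + \<bar>M r / (cos r)\<^sup>2\<bar> * C\<^sup>2) \<longlongrightarrow>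
          \<bar>0\<bar> * B' + \<bar>0\<bar> * (B * C) + \<bar>0\<bar> * C\<^sup>2) (at_left (pi/2))"
        by (intro tendsto_intros lim_N lim_S lim_M)
      then show "((\<lambda>r. \<bar>N r\<bar> * B' + \<bar>S r / cos r\<bar> * (B * C) + \<bar>M r / (cos r)\<^sup>2\<bar> * C\<^sup>2) \<longlongrightarrow> 0)
          (at_left (pi/2))" by simp
    qed
  qed
  \<comment> \<open>The point 1 is an arbitrary interior reference point: \<open>s * Z\<close> is
    negative there and does not increase afterwards, so it cannot tend to 0.\<close>
  have "s * Z r \<le> s * Z 1" if r: "r \<in> {1..<pi/2}" for r
  proof (rule DERIV_nonpos_imp_nonincreasing[of 1 r "\<lambda>x. s * Z x"])
    fix x assume "1 \<le> x" "x \<le> r"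
    then have x: "x \<in> {0..<pi/2}" "x \<in> {0<..<pi/2}" using r by auto
    have "(D\<^sub>1 x * w x + D\<^sub>2 x * w x powr p) * (s * w' x) \<le> 0"
      using DD[OF x(1)] mono[OF x(2)] by (simp add: mult_nonneg_nonpos)
    then show "\<exists>y. ((\<lambda>x. s * Z x) has_real_derivative y) (at x) \<and> y \<le> 0"
      using DERIV_cmult[OF Z_deriv[OF x(1)], of s] by (auto simp: ac_simps)
  qed (use r in auto)
  moreover have "eventually (\<lambda>r. r \<in> {1<..<pi/2}) (at_left (pi/2))"
    using pi_gt3 by (intro eventually_at_left_real) auto
  ultimately have "eventually (\<lambda>r. s * Z r \<le> s * Z 1) (at_left (pi/2))"
    by (auto elim!: eventually_mono)
  then have "0 \<le> s * Z 1" using Z_lim by (intro tendsto_upperbound) auto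
  moreover have "s * Z 1 < 0" using pi_gt3 mono by (intro neg_if) auto
  ultimately show False by simp
qed


section \<open>The multiplier identity and the two concrete multipliers\<close>

lemma multiplier_deriv:
  assumes r: "r \<in> {0..<pi/2}"
    and derivs: "(N has_real_derivative N') (at r)" "(S has_real_derivative S') (at r)"
      "(M has_real_derivative M') (at r)"
    and S: "S r = M' + 4 * tan r * M r" and N': "N' = - l * S r"
  shows "((\<lambda>r. N r * ((w r)\<^sup>2 - w r powr (p + 1)) + S r * w r * w' r - M r * (w' r)\<^sup>2)
    has_real_derivative
      ((2 * N r + S' + 2 * tan r * S r - 2 * l * M r) * w r
        + (2 * l * M r - (p + 1) * N r) * w r powr p) * w' r) (at r)"
proof -
  define w'' where "w'' = 2 * tan r * w' r - l * (w r powr p - w r)"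
  have "((\<lambda>x. x powr (p + 1)) has_real_derivative (p + 1) * w r powr p) (at (w r))"
    using has_real_derivative_powr[OF pos[OF r], of "p + 1"] by simp
  from DERIV_chain2[OF this deriv1[OF r]]
  have dp: "((\<lambda>r. w r powr (p + 1)) has_real_derivative (p + 1) * w r powr p * w' r) (at r)" .
  have d2: "(w' has_real_derivative w'') (at r)" using deriv2[OF r] by (simp add: w''_def)
  have wp: "w r powr (p + 1) = w r * w r powr p" using pos[OF r] by (simp add: powr_add)
  have "((\<lambda>r. N r * ((w r)\<^sup>2 - w r powr (p + 1)) + S r * w r * w' r - M r * (w' r)\<^sup>2)
    has_real_derivative
      N' * ((w r)\<^sup>2 - w r powr (p + 1)) + N r * (2 * w r * w' r - (p + 1) * w r powr p * w' r)
      + (S' * (w r * w' r) + S r * ((w' r)\<^sup>2 + w r * w''))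
      - (M' * (w' r)\<^sup>2 + M r * (2 * w' r * w''))) (at r)"
    by (auto intro!: derivative_eq_intros derivs dp d2 deriv1[OF r] pos[OF r] simp: algebra_simps power2_eq_square)
  also have "N' * ((w r)\<^sup>2 - w r powr (p + 1)) + N r * (2 * w r * w' r - (p + 1) * w r powr p * w' r)
      + (S' * (w r * w' r) + S r * ((w' r)\<^sup>2 + w r * w''))
      - (M' * (w' r)\<^sup>2 + M r * (2 * w' r * w'')) =
      ((2 * N r + S' + 2 * tan r * S r - 2 * l * M r) * w r
        + (2 * l * M r - (p + 1) * N r) * w r powr p) * w' r"
    \<comment> \<open>The condition on \<open>S\<close> cancels the terms in
      \<open>(w' r)^2\<close>. The condition on \<open>N'\<close> cancels those in
      \<open>(w r)^2 - w r powr (p + 1)\<close> without a factor \<open>w' r\<close>. The rest is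
      divisible by \<open>w' r\<close>.\<close>
    unfolding wp N' w''_def S by algebra
  finally show ?thesis .
qed

text \<open>Taking \<open>N\<close> proportional to \<open>M\<close> removes the coefficient of
  \<open>w powr p\<close>. In the other coefficient the \<open>sin^2\<close> part is nonnegative
  because \<open>p <= 5\<close> means \<open>m <= 1\<close>, and the \<open>cos^2\<close> part
  because \<open>l <= 3/4\<close>.\<close>

lemma init_eq_1_if_le:
  assumes l: "l \<le> 3/4" and p5: "p \<le> 5"
  shows "w 0 = 1"
proof -
  \<comment> \<open>The exponent solves \<open>(m + 2) / (p + 1) = 1 - m/2\<close>, which is what
    \<open>N' = - l * S\<close> demands once \<open>N = 2 * q * M\<close> with
    \<open>q = l / (p + 1)\<close>.\<close>
  define m where "m = 2 * (p - 1) / (p + 3)"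
  have m: "0 < m" "m \<le> 1" using p_gt p5 by (auto simp: m_def field_simps)
  have mp: "m * (p + 3) = 2 * (p - 1)" using p_gt by (simp add: m_def)
  then have mp1: "(2 - m) * (p + 1) = 2 * (m + 2)" by algebra
  define q where "q = l / (p + 1)"
  have q_pos: "q > 0" and q: "(p + 1) * q = l" using l_pos p_gt by (auto simp: q_def)
  define P where "P r = cos r powr m" for r :: real
  define S where "S r = (1 - m/2) * (P r * cos r * sin r)" for r
  define M where "M r = P r * (cos r)\<^sup>2 / 2" for r
  define N where "N r = 2 * q * M r" for r
  define D where "D r = P r * ((1 - m/2) * (1 - m) * (sin r)\<^sup>2
      + ((1 - m/2) + 2 * q - l) * (cos r)\<^sup>2)" for r
  have "l - 2 * q = l * ((p - 1) / (p + 1))"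
    using p_gt by (simp add: q_def field_simps)
  also have "(p - 1) / (p + 1) = 2 * m / (m + 2)"
    using p_gt m mp by (simp add: field_simps)
  also have "l * (2 * m / (m + 2)) \<le> 3/4 * (2 * m / (m + 2))"
    using l m by (intro mult_right_mono) auto
  also have "\<dots> \<le> 1 - m/2"
  proof -
    \<comment> \<open>Clearing denominators leaves this product. It vanishes at
      \<open>m = 1\<close>, that is \<open>p = 5\<close>, where the bound \<open>3/4\<close> on
      \<open>l\<close> is sharp for this coefficient.\<close>
    have "(4 + m) * (1 - m) \<ge> 0" using m by simp
    then show ?thesis using m by (simp add: field_simps)
  qed
  finally have coeff: "(1 - m/2) + 2 * q - l \<ge> 0" by simp
  have P_pos: "P r > 0" if "r \<in> {0..<pi/2}" for r using cos_pos[OF that] by (simp add: P_def)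
  have P_lim: "(P \<longlongrightarrow> 0) (at_left (pi/2))"
  proof -
    have "eventually (\<lambda>r::real. 0 \<le> cos r) (at_left (pi/2))"
      by (rule eventually_at_left_pi_half) (simp add: cos_pos less_imp_le)
    then have "((\<lambda>r. cos r powr m) \<longlongrightarrow> cos (pi/2) powr m) (at_left (pi/2))"
      using m by (intro tendsto_powr' tendsto_intros) auto
    then show ?thesis by (simp add: P_def[abs_def])
  qed
  show ?thesis
  proof (rule init_eq_1[of N S M D "\<lambda>_. 0"])
    fix r assume r: "r \<in> {0..<pi/2}"
    note c = cos_pos[OF r]
    \<comment> \<open>Read from right to left, this turns the identities below into polynomial ones
      in \<open>tan r\<close> and \<open>cos r\<close>.\<close>
    have t: "tan r * cos r = sin r" using c by (simp add: tan_def)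
    have dP: "(P has_real_derivative - m * P r * tan r) (at r)"
      unfolding P_def[abs_def] using c
      by (auto intro!: derivative_eq_intros simp: powr_diff tan_def)
    have dM: "(M has_real_derivative - (m + 2) / 2 * P r * cos r * sin r) (at r)"
    proof -
      have "(M has_real_derivative
          (- m * P r * tan r * (cos r)\<^sup>2 - 2 * P r * cos r * sin r) / 2) (at r)"
        unfolding M_def[abs_def] by (auto intro!: derivative_eq_intros dP simp: field_simps power2_eq_square)
      also have "(- m * P r * tan r * (cos r)\<^sup>2 - 2 * P r * cos r * sin r) / 2
          = - (m + 2) / 2 * P r * cos r * sin r"
        unfolding t[symmetric] by (simp add: algebra_simps power2_eq_square add_divide_distrib)
      finally show ?thesis .
    qed
    have dN: "(N has_real_derivative - l * S r) (at r)"
    proof -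
      have "(m + 2) / (p + 1) = 1 - m/2" using mp1 p_gt by (simp add: field_simps)
      moreover have "(m + 2) * q = l * ((m + 2) / (p + 1))" by (simp add: q_def)
      ultimately have mq: "(m + 2) * q = l * (1 - m/2)" by (simp only:)
      have "2 * q * (- (m + 2) / 2 * P r * cos r * sin r) = - ((m + 2) * q) * (P r * cos r * sin r)"
        by (simp add: field_simps)
      also have "\<dots> = - l * S r" unfolding mq S_def by simp
      finally show ?thesis
        unfolding N_def[abs_def] using DERIV_cmult[OF dM, of "2 * q"] by simp
    qed
    have dS: "(S has_real_derivative (1 - m/2) * P r * ((cos r)\<^sup>2 - (1 + m) * (sin r)\<^sup>2)) (at r)"
    proof -
      have "((\<lambda>r. P r * cos r * sin r) has_real_derivative
          - m * P r * tan r * cos r * sin r - P r * (sin r)\<^sup>2 + P r * (cos r)\<^sup>2) (at r)"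
        by (auto intro!: derivative_eq_intros dP simp: algebra_simps power2_eq_square)
      also have "- m * P r * tan r * cos r * sin r - P r * (sin r)\<^sup>2 + P r * (cos r)\<^sup>2
          = P r * ((cos r)\<^sup>2 - (1 + m) * (sin r)\<^sup>2)"
        unfolding t[symmetric] by (simp add: algebra_simps power2_eq_square)
      finally show ?thesis
        unfolding S_def[abs_def] mult.assoc[of "1 - m/2"] by (rule DERIV_cmult)
    qed
    have S: "S r = - (m + 2) / 2 * P r * cos r * sin r + 4 * tan r * M r"
      unfolding S_def M_def t[symmetric] by (simp add: field_simps power2_eq_square)
    have D1: "2 * N r + (1 - m/2) * P r * ((cos r)\<^sup>2 - (1 + m) * (sin r)\<^sup>2)
        + 2 * tan r * S r - 2 * l * M r = D r"
      unfolding N_def S_def M_def D_def t[symmetric]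
      by (simp add: field_simps power2_eq_square)
    have D2: "2 * l * M r - (p + 1) * N r = 0"
      unfolding N_def q[symmetric] by (simp add: algebra_simps)
    show "((\<lambda>r. N r * ((w r)\<^sup>2 - w r powr (p + 1)) + S r * w r * w' r - M r * (w' r)\<^sup>2)
        has_real_derivative (D r * w r + 0 * w r powr p) * w' r) (at r)"
      using multiplier_deriv[OF r dN dS dM S refl] unfolding D1 D2 .
    show "N r \<ge> 0" using q_pos P_pos[OF r] by (simp add: N_def M_def)
    show "D r \<ge> 0" unfolding D_def
      using m coeff P_pos[OF r] by (intro mult_nonneg_nonneg add_nonneg_nonneg) auto
  next
    have "N 0 > 0" using q_pos by (simp add: N_def M_def P_def)
    then show "N 0 > 0 \<or> (\<forall>r\<in>{0<..<pi/2}. D r > 0 \<or> (0::real) > 0)" ..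
    show "(N \<longlongrightarrow> 0) (at_left (pi/2))"
      unfolding N_def[abs_def] M_def by (rule tendsto_eq_intros P_lim refl | simp)+
    have "((\<lambda>r. (1 - m/2) * P r * sin r) \<longlongrightarrow> 0) (at_left (pi/2))"
      by (rule tendsto_eq_intros P_lim refl | simp)+
    moreover have "eventually (\<lambda>r. (1 - m/2) * P r * sin r = S r / cos r) (at_left (pi/2))"
      using cos_pos by (intro eventually_at_left_pi_half) (force simp: S_def)
    ultimately show "((\<lambda>r. S r / cos r) \<longlongrightarrow> 0) (at_left (pi/2))"
      by (rule Lim_transform_eventually)
    have "((\<lambda>r. P r / 2) \<longlongrightarrow> 0) (at_left (pi/2))"
      by (rule tendsto_eq_intros P_lim refl | simp)+
    moreover have "eventually (\<lambda>r. P r / 2 = M r / (cos r)\<^sup>2) (at_left (pi/2))"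
      using cos_pos by (intro eventually_at_left_pi_half) (force simp: M_def)
    ultimately show "((\<lambda>r. M r / (cos r)\<^sup>2) \<longlongrightarrow> 0) (at_left (pi/2))"
      by (rule Lim_transform_eventually)
  qed simp
qed

text \<open>Here \<open>k = - a'\<close> and \<open>a'' + 4 * \<omega>^2 * a = 0\<close>. With
  \<open>M = a * cos^2 / 2\<close>, the demand that the coefficient of \<open>w\<close> vanish
  determines \<open>N\<close>, and the equation for \<open>a\<close> makes
  \<open>N' = - l * S\<close> hold. What remains is the sign of \<open>N\<close> and of the
  coefficient of \<open>w powr p\<close>.\<close>

lemma init_eq_1_if_multiplier:
  fixes a k :: "real \<Rightarrow> real"
  assumes p5: "p \<le> 5" and \<omega>: "0 \<le> \<omega>" "\<omega> < 1/2" and l: "l = 1 - \<omega>\<^sup>2"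
    and da: "\<And>r. (a has_real_derivative - k r) (at r)"
    and dk: "\<And>r. (k has_real_derivative 4 * \<omega>\<^sup>2 * a r) (at r)"
    and a_end: "a (pi/2) = 0" and a_pos: "\<And>r. r \<in> {0..<pi/2} \<Longrightarrow> a r > 0"
  shows "w 0 = 1"
proof -
  have \<omega>2: "4 * \<omega>\<^sup>2 < 1"
    using power_strict_mono[of \<omega> "1/2" 2] \<omega> by (simp add: power2_eq_square)
  \<comment> \<open>The function \<open>h\<close> carries the sign of \<open>N\<close>: it vanishes
    at \<open>pi/2\<close> with \<open>a\<close>, and \<omega> < 1/2 makes it decrease to 0, hence
    positive before.\<close>
  define h where "h r = k r * cos r - a r * sin r" for r
  have dh: "(h has_real_derivative (4 * \<omega>\<^sup>2 - 1) * a r * cos r) (at r)" for r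
    unfolding h_def[abs_def] by (auto intro!: derivative_eq_intros da dk simp: algebra_simps)
  have h_pos: "h r > 0" if r: "r \<in> {0..<pi/2}" for r
  proof -
    have "h (pi/2) < h r"
    proof (rule DERIV_neg_imp_decreasing_open[of r "pi/2" h])
      show "continuous_on {r..pi/2} h"
        by (auto intro!: continuous_at_imp_continuous_on DERIV_isCont[OF dh])
      fix x assume "r < x" "x < pi/2"
      then have "(4 * \<omega>\<^sup>2 - 1) * a x * cos x < 0"
        using \<omega>2 a_pos[of x] cos_pos[of x] r by (simp add: mult_neg_pos)
      then show "\<exists>y. (h has_real_derivative y) (at x) \<and> y < 0" using dh by blast
    qed (use r in auto)
    then show ?thesis by (simp add: h_def a_end)
  qed
  \<comment> \<open>\<open>G\<close> is the coefficient \<open>D\<close> below at the critical exponent \<open>p = 5\<close>, the worst case.\<close>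
  define G where
    "G r = 3 * a r * (sin r)\<^sup>2 - 3 * k r * sin r * cos r + (1 - 4 * \<omega>\<^sup>2) * a r * (cos r)\<^sup>2" for r
  have dG: "(G has_real_derivative - (4 * l * cos r * h r)) (at r)" for r
  proof -
    have "(G has_real_derivative
      3 * (- k r * (sin r)\<^sup>2 + 2 * a r * sin r * cos r)
      - 3 * (4 * \<omega>\<^sup>2 * a r * sin r * cos r + k r * (cos r)\<^sup>2 - k r * (sin r)\<^sup>2)
      + (1 - 4 * \<omega>\<^sup>2) * (- k r * (cos r)\<^sup>2 - 2 * a r * sin r * cos r)) (at r)"
      unfolding G_def[abs_def]
      by (auto intro!: derivative_eq_intros da dk simp: algebra_simps power2_eq_square)
    also have "3 * (- k r * (sin r)\<^sup>2 + 2 * a r * sin r * cos r)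
      - 3 * (4 * \<omega>\<^sup>2 * a r * sin r * cos r + k r * (cos r)\<^sup>2 - k r * (sin r)\<^sup>2)
      + (1 - 4 * \<omega>\<^sup>2) * (- k r * (cos r)\<^sup>2 - 2 * a r * sin r * cos r) = - (4 * l * cos r * h r)"
      unfolding l h_def by (simp add: algebra_simps power2_eq_square)
    finally show ?thesis .
  qed
  have G_pos: "G r > 0" if r: "r \<in> {0..<pi/2}" for r
  proof -
    \<comment> \<open>\<open>G\<close> also vanishes at \<open>pi/2\<close>, and positivity of
      \<open>h\<close> makes it decrease towards that value.\<close>
    have "G (pi/2) < G r"
    proof (rule DERIV_neg_imp_decreasing_open[of r "pi/2" G])
      show "continuous_on {r..pi/2} G"
        by (auto intro!: continuous_at_imp_continuous_on DERIV_isCont[OF dG])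
      fix x assume "r < x" "x < pi/2"
      then have "- (4 * l * cos x * h x) < 0"
        using l_pos h_pos[of x] cos_pos[of x] r by simp
      then show "\<exists>y. (G has_real_derivative y) (at x) \<and> y < 0" using dG by blast
    qed (use r in auto)
    then show ?thesis by (simp add: G_def a_end)
  qed
  define N where "N r = (sin r * h r + \<omega>\<^sup>2 * a r * (cos r)\<^sup>2) / 2" for r
  define S where "S r = cos r * (a r * sin r - k r * cos r / 2)" for r
  define M where "M r = a r * (cos r)\<^sup>2 / 2" for r
  define D where "D r = 2 * l * M r - (p + 1) * N r" for r
  have N_nonneg: "N r \<ge> 0" if r: "r \<in> {0..<pi/2}" for r
    using sin_ge_zero[of r] r h_pos[OF r] a_pos[OF r] by (simp add: N_def)
  have D_pos: "D r > 0" if r: "r \<in> {0..<pi/2}" for r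
  proof -
    have "G r = 2 * l * M r - 6 * N r"
      by (simp add: G_def M_def N_def l h_def field_simps power2_eq_square)
    also have "\<dots> \<le> D r"
      unfolding D_def using p5 N_nonneg[OF r] mult_right_mono[of "p + 1" 6 "N r"] by simp
    finally show ?thesis using G_pos[OF r] by simp
  qed
  have lim: "(f \<longlongrightarrow> f (pi/2)) (at_left (pi/2))"
    if "\<And>r. (f has_real_derivative f' r) (at r)" for f f' :: "real \<Rightarrow> real"
    using continuous_at_imp_continuous_at_within[OF DERIV_isCont[OF that]]
    by (simp add: continuous_within)
  note lim_a = lim[OF da] and lim_k = lim[OF dk] and lim_h = lim[OF dh]
  show ?thesis
  proof (rule init_eq_1[of N S M "\<lambda>_. 0" D])
    fix r assume r: "r \<in> {0..<pi/2}"
    have t: "tan r * cos r = sin r" using cos_pos[OF r] by (simp add: tan_def)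
    have dN: "(N has_real_derivative (cos r * h r + sin r * ((4 * \<omega>\<^sup>2 - 1) * a r * cos r)
        - \<omega>\<^sup>2 * (k r * (cos r)\<^sup>2 + 2 * a r * sin r * cos r)) / 2) (at r)"
      unfolding N_def[abs_def]
      by (auto intro!: derivative_eq_intros dh da simp: field_simps power2_eq_square)
    have dS: "(S has_real_derivative - sin r * (a r * sin r - k r * cos r / 2)
        + cos r * (a r * cos r - 2 * \<omega>\<^sup>2 * a r * cos r - k r * sin r / 2)) (at r)"
      unfolding S_def[abs_def]
      by (auto intro!: derivative_eq_intros dk da simp: field_simps power2_eq_square)
    have dM: "(M has_real_derivative - (k r * (cos r)\<^sup>2 + 2 * a r * sin r * cos r) / 2) (at r)"
      unfolding M_def[abs_def]
      by (auto intro!: derivative_eq_intros da simp: field_simps power2_eq_square)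
    have S: "S r = - (k r * (cos r)\<^sup>2 + 2 * a r * sin r * cos r) / 2 + 4 * tan r * M r"
      unfolding S_def M_def t[symmetric] by (simp add: field_simps power2_eq_square)
    have N': "(cos r * h r + sin r * ((4 * \<omega>\<^sup>2 - 1) * a r * cos r)
        - \<omega>\<^sup>2 * (k r * (cos r)\<^sup>2 + 2 * a r * sin r * cos r)) / 2 = - l * S r"
      unfolding S_def l h_def by (simp add: field_simps power2_eq_square)
    have D1: "2 * N r + (- sin r * (a r * sin r - k r * cos r / 2)
        + cos r * (a r * cos r - 2 * \<omega>\<^sup>2 * a r * cos r - k r * sin r / 2))
        + 2 * tan r * S r - 2 * l * M r = 0"
      unfolding N_def S_def M_def h_def l t[symmetric]
      by (simp add: field_simps power2_eq_square)
    show "((\<lambda>r. N r * ((w r)\<^sup>2 - w r powr (p + 1)) + S r * w r * w' r - M r * (w' r)\<^sup>2)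
        has_real_derivative (0 * w r + D r * w r powr p) * w' r) (at r)"
      using multiplier_deriv[OF r dN dS dM S N'] unfolding D1 D_def[symmetric] .
    show "N r \<ge> 0" by (rule N_nonneg[OF r])
    show "D r \<ge> 0" using D_pos[OF r] by simp
  next
    show "N 0 > 0 \<or> (\<forall>r\<in>{0<..<pi/2}. (0::real) > 0 \<or> D r > 0)" using D_pos by simp
    show "(N \<longlongrightarrow> 0) (at_left (pi/2))"
      unfolding N_def[abs_def]
      by (rule tendsto_eq_intros lim_a lim_h refl | simp add: h_def a_end)+
    have "((\<lambda>r. a r * sin r - k r * cos r / 2) \<longlongrightarrow> 0) (at_left (pi/2))"
      by (rule tendsto_eq_intros lim_a lim_k refl | simp add: a_end)+
    moreover have "eventually (\<lambda>r. a r * sin r - k r * cos r / 2 = S r / cos r) (at_left (pi/2))"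
      using cos_pos by (intro eventually_at_left_pi_half) (force simp: S_def)
    ultimately show "((\<lambda>r. S r / cos r) \<longlongrightarrow> 0) (at_left (pi/2))"
      by (rule Lim_transform_eventually)
    have "((\<lambda>r. a r / 2) \<longlongrightarrow> 0) (at_left (pi/2))"
      by (rule tendsto_eq_intros lim_a refl | simp add: a_end)+
    moreover have "eventually (\<lambda>r. a r / 2 = M r / (cos r)\<^sup>2) (at_left (pi/2))"
      using cos_pos by (intro eventually_at_left_pi_half) (force simp: M_def)
    ultimately show "((\<lambda>r. M r / (cos r)\<^sup>2) \<longlongrightarrow> 0) (at_left (pi/2))"
      by (rule Lim_transform_eventually)
  qed simp
qed

text \<open>The bound \<open>l > 3/4\<close> is \<omega> < 1/2, which keeps the argument of the sine
  below \<open>pi\<close> and the sine positive. At \<omega> = 0 the sine degenerates to 0, and the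
  linear solution \<open>pi/2 - r\<close> replaces it.\<close>

lemma init_eq_1_if_gt:
  assumes l: "3/4 < l" "l \<le> 1" and p5: "p \<le> 5"
  shows "w 0 = 1"
proof -
  define \<omega> where "\<omega> = sqrt (1 - l)"
  have l_eq: "l = 1 - \<omega>\<^sup>2" and "0 \<le> \<omega>" using l by (auto simp: \<omega>_def)
  have "\<omega>\<^sup>2 < (1/2)\<^sup>2" using l l_eq by (simp add: power2_eq_square)
  then have "\<omega> < 1/2" by (rule power2_less_imp_less) simp
  show ?thesis
  proof (cases "\<omega> = 0")
    case True
    show ?thesis
      by (rule init_eq_1_if_multiplier[of \<omega> "\<lambda>r. pi/2 - r" "\<lambda>_. 1"])
        (use p5 True l_eq in \<open>auto intro!: derivative_eq_intros\<close>)
  next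
    case False
    then have pos: "\<omega> > 0" using \<open>0 \<le> \<omega>\<close> by simp
    show ?thesis
    proof (rule init_eq_1_if_multiplier[of \<omega> "\<lambda>r. sin (2 * \<omega> * (pi/2 - r))"
          "\<lambda>r. 2 * \<omega> * cos (2 * \<omega> * (pi/2 - r))"])
      fix r assume r: "r \<in> {0..<pi/2}"
      have "2 * \<omega> * (pi/2 - r) \<le> 1 * (pi/2 - r)"
        using \<open>\<omega> < 1/2\<close> r by (intro mult_right_mono) auto
      also have "\<dots> < pi" using r by auto
      finally show "sin (2 * \<omega> * (pi/2 - r)) > 0"
        using pos r by (intro sin_gt_zero) auto
    qed (use p5 l_eq pos \<open>\<omega> < 1/2\<close> in
        \<open>auto intro!: derivative_eq_intros simp: power2_eq_square\<close>)
  qed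
qed

lemma eq_1:
  assumes "l \<le> 1" "p \<le> 5" "r \<in> {0..<pi/2}"
  shows "w r = 1"
  using init_eq_1_if_le init_eq_1_if_gt assms by (cases "l \<le> 3/4") (auto intro: eq_1_if_init_eq_1)

end

section \<open>Reduction to the normalized equation\<close>

theorem corollary1:
  fixes l p :: real and u :: "real \<Rightarrow> real"
  assumes "0 < l" and "l \<le> 1" and "1 < p" and "p \<le> 5"
    and "continuous_on {-(pi/2)..pi/2} u"
    and "C2_on {-(pi/2)<..<pi/2} u"
    and "\<forall>r\<in>{-(pi/2)..pi/2}. u (- r) = u r"
    and "\<forall>r\<in>{-(pi/2)<..<pi/2}. u r > 0"
    and "\<forall>r\<in>{-(pi/2)<..<pi/2}.
           deriv (deriv u) r - 2 * tan r * deriv u r - l * u r + u r powr p = 0"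
    and "u (-(pi/2)) = u (pi/2)" and "u (pi/2) \<ge> 0"
  shows "\<forall>r\<in>{-(pi/2)..pi/2}. u r = \<bar>l\<bar> powr (1 / (p - 1))"
proof -
  let ?I = "{-(pi/2)<..<pi/2}"
  \<comment> \<open>\<open>c\<close> is the positive constant solution, so that
    \<open>c powr (p - 1) = l\<close>; division by \<open>c\<close> moves it to 1.\<close>
  define c where "c = l powr (1 / (p - 1))"
  have c_pos: "c > 0" using assms(1) by (simp add: c_def)
  have c_powr: "c powr p = c * l"
  proof -
    have "c powr (1 + (p - 1)) = c * l"
      unfolding powr_add using c_pos assms(1,3) by (simp add: c_def powr_powr)
    then show ?thesis by simp
  qed
  have du: "(u has_real_derivative deriv u r) (at r)"
    and ddu: "(deriv u has_real_derivative deriv (deriv u) r) (at r)" if "r \<in> ?I" for r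
    using assms(6) that at_within_open[OF that]
    unfolding C2_on_def differentiable_on_def DERIV_deriv_iff_real_differentiable by metis+
  have even: "u (- r) = u r" if "r \<in> {-(pi/2)..pi/2}" for r using assms(7) that by blast
  \<comment> \<open>Near 0 the function agrees with its reflection, whose derivative there has the
    opposite sign. This supplies \<open>init\<close>.\<close>
  have "deriv u 0 = 0"
  proof -
    have "((\<lambda>r. u (- r)) has_real_derivative - deriv u 0) (at 0)"
      using DERIV_mirror[of u "deriv u 0" 0] du[of 0] by simp
    then have "(u has_real_derivative - deriv u 0) (at 0)"
      by (rule has_field_derivative_transform_within_open[of _ _ _ ?I]) (auto intro!: even)
    then have "deriv u 0 = - deriv u 0" using du[of 0] by (intro DERIV_unique[of u _ 0]) auto
    then show ?thesis by simp
  qed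
  interpret normalized_solution l p "\<lambda>r. u r / c" "\<lambda>r. deriv u r / c"
  proof
    show "continuous_on {0..pi/2} (\<lambda>r. u r / c)"
      using c_pos by (intro continuous_intros continuous_on_subset[OF assms(5)]) auto
    fix r :: real assume r: "r \<in> {0..<pi/2}"
    then have rI: "r \<in> ?I" by auto
    show "u r / c > 0" using assms(8) rI c_pos by simp
    show "((\<lambda>r. u r / c) has_real_derivative deriv u r / c) (at r)"
      by (rule DERIV_cdivide[OF du[OF rI]])
    have "u r powr p / c = l * (u r / c) powr p"
      using assms(1,8) rI c_pos by (simp add: powr_divide c_powr)
    moreover have "deriv (deriv u) r = 2 * tan r * deriv u r + l * u r - u r powr p"
      using assms(9) rI by fastforce
    ultimately have "deriv (deriv u) r / c
        = 2 * tan r * (deriv u r / c) - l * ((u r / c) powr p - u r / c)"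
      by (simp add: add_divide_distrib diff_divide_distrib right_diff_distrib)
    then show "((\<lambda>r. deriv u r / c) has_real_derivative
        2 * tan r * (deriv u r / c) - l * ((u r / c) powr p - u r / c)) (at r)"
      using DERIV_cdivide[OF ddu[OF rI], of c] by simp
  qed (use assms \<open>deriv u 0 = 0\<close> in auto)
  have nonneg: "u r = c" if "r \<in> {0..<pi/2}" for r
    using eq_1[OF assms(2,4) that] c_pos by (simp add: field_simps)
  \<comment> \<open>Evenness carries the value to negative \<open>r\<close>; continuity then carries
    it to both endpoints, where the equation says nothing.\<close>
  have "u r = c" if "r \<in> ?I" for r
    using nonneg[of "\<bar>r\<bar>"] even[of r] that by (cases "r \<ge> 0") auto
  moreover have "closure ?I = {-(pi/2)..pi/2}" by (simp add: closure_greaterThanLessThan)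
  ultimately have "\<forall>r\<in>{-(pi/2)..pi/2}. u r = c"
    using continuous_constant_on_closure[of ?I u c] assms(5) by metis
  then show ?thesis using assms(1) by (simp add: c_def)
qed

end
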